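(* Let $(X,\{cc_\lambda\}_{\lambda\in[0,1]})$ be a convex space and let $d$ be a metric on $X$. Consider the inequality $$d(cc_\lambda(y,x),cc_\lambda(z,x))\le\lambda\, d(y,z)\quad\text{for all }x,y,z\in X,\ \lambda\in[0,1].\qquad( * )$$ (a) $(X,\{cc_\lambda\},d)$ is a convex subset of a Banach space if and only if $( * )$ holds. (b) If $d$ is complete, then $(X,\{cc_\lambda\},d)$ is a closed convex subset of a Banach space if and only if $( * )$ holds. Here "$(X,\{cc_\lambda\},d)$ is a (closed) convex subset of a Banach space" means that there are a real Banach space $B$, a (closed) convex subset $C\subseteq B$ and a bijection $\varphi\colon X\to C$ with $\varphi(cc_\lambda(x,y))=\lambda\varphi(x)+(1-\lambda)\varphi(y)$ and $\|\varphi(x)-\varphi(y)\|=d(x,y)$ for all $x,y\in X$, $\lambda\in[0,1]$.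
   Context: A convex space is a set $X$ with a family of binary operations $\{cc_\lambda\}_{\lambda\in[0,1]}$ on $X$ such that for all $x,y,z\in X$ and $\lambda,\mu\in[0,1]$: (i) $cc_0(x,y)=y$; (ii) $cc_\lambda(x,x)=x$; (iii) $cc_\lambda(x,y)=cc_{1-\lambda}(y,x)$; (iv) $cc_\lambda(cc_\mu(x,y),z)=cc_{\lambda\mu}(x,cc_\nu(y,z))$, where $\nu\in[0,1]$ is arbitrary if $\lambda=\mu=1$ and $\nu=\frac{\lambda(1-\mu)}{1-\lambda\mu}$ otherwise. (Intuitively, $cc_\lambda(x,y)$ stands for $\lambda x+(1-\lambda)y$.) *)

theory Defs
  imports "HOL-Analysis.Analysis" "HOL-Probability.Discrete_Topology"
begin

locale convex_space =
  fixes X :: "'a set" and cc :: "real \<Rightarrow> 'a \<Rightarrow> 'a \<Rightarrow> 'a"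
  assumes cc_closed: "\<And>l x y. \<lbrakk>l \<in> {0..1}; x \<in> X; y \<in> X\<rbrakk> \<Longrightarrow> cc l x y \<in> X"
    and cc_zero: "\<And>x y. \<lbrakk>x \<in> X; y \<in> X\<rbrakk> \<Longrightarrow> cc 0 x y = y"
    and cc_idem: "\<And>l x. \<lbrakk>l \<in> {0..1}; x \<in> X\<rbrakk> \<Longrightarrow> cc l x x = x"
    and cc_commute: "\<And>l x y. \<lbrakk>l \<in> {0..1}; x \<in> X; y \<in> X\<rbrakk> \<Longrightarrow> cc l x y = cc (1 - l) y x"
    and cc_assoc: "\<And>l m n x y z.
          \<lbrakk>l \<in> {0..1}; m \<in> {0..1}; n \<in> {0..1}; x \<in> X; y \<in> X; z \<in> X;
           \<not> (l = 1 \<and> m = 1) \<longrightarrow> n = l * (1 - m) / (1 - l * m)\<rbrakk>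
          \<Longrightarrow> cc l (cc m x y) z = cc (l * m) x (cc n y z)"

definition cc_contractive ::
    "'a set \<Rightarrow> (real \<Rightarrow> 'a \<Rightarrow> 'a \<Rightarrow> 'a) \<Rightarrow> ('a \<Rightarrow> 'a \<Rightarrow> real) \<Rightarrow> bool" where
  "cc_contractive X cc d \<longleftrightarrow>
     (\<forall>x\<in>X. \<forall>y\<in>X. \<forall>z\<in>X. \<forall>l\<in>{0..1}. d (cc l y x) (cc l z x) \<le> l * d y z)"

definition cc_isometry ::
    "'a set \<Rightarrow> (real \<Rightarrow> 'a \<Rightarrow> 'a \<Rightarrow> 'a) \<Rightarrow> ('a \<Rightarrow> 'a \<Rightarrow> real)
     \<Rightarrow> 'b::real_normed_vector set \<Rightarrow> ('a \<Rightarrow> 'b) \<Rightarrow> bool" where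
  "cc_isometry X cc d C \<phi> \<longleftrightarrow>
     bij_betw \<phi> X C \<and>
     (\<forall>x\<in>X. \<forall>y\<in>X. \<forall>l\<in>{0..1}. \<phi> (cc l x y) = l *\<^sub>R \<phi> x + (1 - l) *\<^sub>R \<phi> y) \<and>
     (\<forall>x\<in>X. \<forall>y\<in>X. norm (\<phi> x - \<phi> y) = d x y)"

definition is_convex_subset_of ::
    "'b::banach itself \<Rightarrow> 'a set \<Rightarrow> (real \<Rightarrow> 'a \<Rightarrow> 'a \<Rightarrow> 'a) \<Rightarrow> ('a \<Rightarrow> 'a \<Rightarrow> real) \<Rightarrow> bool" where
  "is_convex_subset_of _ X cc d \<longleftrightarrow>
     (\<exists>(C :: 'b set) \<phi>. convex C \<and> cc_isometry X cc d C \<phi>)"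

definition is_closed_convex_subset_of ::
    "'b::banach itself \<Rightarrow> 'a set \<Rightarrow> (real \<Rightarrow> 'a \<Rightarrow> 'a \<Rightarrow> 'a) \<Rightarrow> ('a \<Rightarrow> 'a \<Rightarrow> real) \<Rightarrow> bool" where
  "is_closed_convex_subset_of _ X cc d \<longleftrightarrow>
     (\<exists>(C :: 'b set) \<phi>. closed C \<and> convex C \<and> cc_isometry X cc d C \<phi>)"

instance bcontfun :: (metric_space, banach) banach ..

text \<open>
  HOL cannot quantify existentially over types, so ``there is a Banach space'' needs one
  sufficiently large type of class \<^class>\<open>banach\<close>. The type below is the Banach space of all
  bounded functions on the set \<^typ>\<open>'a \<Rightarrow> real\<close> with the supremum norm (continuity is void,
  the domain being discrete). It contains a copy of every convex subset \<open>C\<close> indexed by a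
  subset of \<^typ>\<open>'a\<close> of any Banach space: the dual unit ball of the closed span \<open>S\<close> of \<open>C\<close>
  is indexed by the restrictions of its elements to \<open>C\<close>, hence by functions
  \<^typ>\<open>'a \<Rightarrow> real\<close>, and evaluation embeds \<open>S\<close> linearly and isometrically, with closed image.
  Embeddability in some Banach space is therefore embeddability in this one. To assert that
  embeddability in some Banach space is equivalent to a condition \<open>P\<close> without relying on this
  remark, state the equivalence for this type together with the implication from embeddability
  in an arbitrary type of class \<^class>\<open>banach\<close> to \<open>P\<close>.
\<close>

type_synonym 'a large_banach = "('a \<Rightarrow> real) discrete \<Rightarrow>\<^sub>C real"

end

(*
  A contractive metric satisfies d (cc l y x, cc l z x) = l d (y, z), so it behaves like a norm of
  differences. To separate points without building the ambient vector space, consider functions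
  p on X * X with the triangle inequality and this homogeneity: they play the role of sublinear
  functionals applied to x - y. As in the proof of the Hahn-Banach theorem, Zorn's lemma gives
  minimal ones, these are antisymmetric, and an antisymmetric p is a difference f x - f y of an
  affine f. Hence the affine functions that are 1-Lipschitz for d attain every distance, and
  evaluating them (normalised at a base point) embeds X isometrically into bounded functions.
*)
theory Submission
  imports Defs
begin

section \<open>Arithmetic of convex combinations\<close>

lemma assoc_coeff:
  fixes l m :: real
  assumes "l \<in> {0..1}" "m \<in> {0..1}" "\<not> (l = 1 \<and> m = 1)"
  shows "l * m < 1" "l * (1 - m) / (1 - l * m) \<in> {0..1}"
proof -
  show lm: "l * m < 1"
  proof (cases "m = 1")
    case False
    have "l * m \<le> 1 * m" using assms by (intro mult_right_mono) auto
    moreover have "m < 1" using False assms by auto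
    ultimately show ?thesis by linarith
  qed (use assms in auto)
  have "0 \<le> l * (1 - m)" using assms by simp
  moreover have "l * (1 - m) \<le> 1 - l * m" using assms by (simp add: right_diff_distrib)
  ultimately show "l * (1 - m) / (1 - l * m) \<in> {0..1}" using lm by simp
qed

context convex_space
begin

lemma cc_one: "x \<in> X \<Longrightarrow> y \<in> X \<Longrightarrow> cc 1 x y = x"
  using cc_commute[of 1 x y] cc_zero[of y x] by simp

text \<open>Associativity brings the two copies of \<open>a\<close> together, and idempotence merges
  them.\<close>

lemma cc_absorb_right:
  assumes "l \<in> {0..1}" "m \<in> {0..1}" "x \<in> X" "a \<in> X"
  shows "cc l (cc m x a) a = cc (l * m) x a"
proof -
  \<comment> \<open>For \<open>l = m = 1\<close> associativity leaves the inner weight free; 0 is an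
    arbitrary choice.\<close>
  define n where "n = (if l = 1 \<and> m = 1 then 0 else l * (1 - m) / (1 - l * m))"
  have n: "n \<in> {0..1}"
    unfolding n_def using assoc_coeff(2)[OF assms(1,2)] by simp
  then have "cc l (cc m x a) a = cc (l * m) x (cc n a a)"
    using assms by (intro cc_assoc) (simp_all add: n_def)
  then show ?thesis using assms n by (simp add: cc_idem)
qed

text \<open>Both sides are the mixture of \<open>x\<close>, \<open>y\<close>, \<open>z\<close> with weights \<open>l * m\<close>, \<open>l * (1 - m)\<close>, \<open>1 - l\<close>.\<close>
lemma cc_swap:
  assumes "l \<in> {0..1}" "m \<in> {0..1}" "l' \<in> {0..1}" "m' \<in> {0..1}" "x \<in> X" "y \<in> X" "z \<in> X"
    and eq: "l' * m' = l * m" "1 - l' = l * (1 - m)"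
  shows "cc l (cc m x y) z = cc l' (cc m' x z) y"
proof -
  have eq3: "l' * (1 - m') = 1 - l"
    using eq by (simp add: algebra_simps)
  \<comment> \<open>If \<open>l = m = 1\<close>, then \<open>l' = m' = 1\<close> as well, so both
    uses of associativity leave the inner weight free and the default 1 is harmless.\<close>
  define n where "n = (if l = 1 \<and> m = 1 then 1 else l * (1 - m) / (1 - l * m))"
  have n: "n \<in> {0..1}"
    unfolding n_def using assoc_coeff(2)[OF assms(1,2)] by simp
  have n': "1 - n = l' * (1 - m') / (1 - l' * m')" if "\<not> (l' = 1 \<and> m' = 1)"
  proof -
    have "l * m < 1" using assoc_coeff(1)[OF assms(3,4) that] eq by simp
    moreover have "\<not> (l = 1 \<and> m = 1)" using calculation by auto
    ultimately show ?thesis unfolding n_def eq3 eq(1)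
      by (simp add: field_simps)
  qed
  have "cc l (cc m x y) z = cc (l * m) x (cc n y z)"
    using assms(1-7) n by (intro cc_assoc) (simp_all add: n_def)
  also have "\<dots> = cc (l' * m') x (cc (1 - n) z y)"
    using assms(1-7) n eq(1) by (simp add: cc_commute[of n y z])
  also have "\<dots> = cc l' (cc m' x z) y"
    using assms(1-7) n n' by (intro cc_assoc[symmetric]) simp_all
  finally show ?thesis .
qed

lemma cc_absorb_left:
  assumes "l \<in> {0..1}" "m \<in> {0..1}" "x \<in> X" "y \<in> X"
  shows "cc l (cc m y x) y = cc (1 - l * (1 - m)) y x"
proof -
  have "l * (1 - m) \<in> {0..1}" using assms by (auto simp: mult_le_one)
  then show ?thesis
    using assms cc_commute[of m y x] cc_absorb_right[of l "1 - m" x y]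
      cc_commute[of "l * (1 - m)" x y] by simp
qed

section \<open>Gauges, and minimal gauges by Zorn's lemma\<close>

text \<open>Values may be negative. Setting them to 0 off \<open>X\<close> makes the pointwise
  order, and hence minimality, depend on the values on \<open>X\<close> alone.\<close>

definition affine_gauge :: "('a \<Rightarrow> 'a \<Rightarrow> real) \<Rightarrow> bool" where
  "affine_gauge p \<longleftrightarrow>
     (\<forall>x\<in>X. \<forall>y\<in>X. \<forall>z\<in>X. p x z \<le> p x y + p y z) \<and>
     (\<forall>x\<in>X. \<forall>y\<in>X. \<forall>z\<in>X. \<forall>l\<in>{0..1}. p (cc l y x) (cc l z x) = l * p y z) \<and>
     (\<forall>x y. x \<notin> X \<or> y \<notin> X \<longrightarrow> p x y = 0)"

lemma affine_gauge_triangle: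
  "affine_gauge p \<Longrightarrow> x \<in> X \<Longrightarrow> y \<in> X \<Longrightarrow> z \<in> X \<Longrightarrow> p x z \<le> p x y + p y z"
  by (simp add: affine_gauge_def)

lemma affine_gauge_cc:
  "affine_gauge p \<Longrightarrow> l \<in> {0..1} \<Longrightarrow> x \<in> X \<Longrightarrow> y \<in> X \<Longrightarrow> z \<in> X
    \<Longrightarrow> p (cc l y x) (cc l z x) = l * p y z"
  by (simp add: affine_gauge_def)

lemma affine_gauge_cc_left:
  assumes "affine_gauge p" "l \<in> {0..1}" "x \<in> X" "y \<in> X" "z \<in> X"
  shows "p (cc l x y) (cc l x z) = (1 - l) * p y z"
  using assms affine_gauge_cc[of p "1 - l" x y z] by (simp add: cc_commute[of l])

lemma affine_gauge_refl: "affine_gauge p \<Longrightarrow> x \<in> X \<Longrightarrow> p x x = 0"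
  using affine_gauge_cc[of p 0 x x x] by (simp add: cc_zero)

text \<open>On \<open>X\<close>, \<open>p x x = 0\<close> and the triangle inequality bound
  \<open>p x y\<close> below by \<open>- d y x\<close>, so the infimum is finite. It keeps the
  triangle inequality because two members of a chain can be replaced by the smaller one.\<close>

lemma affine_gauge_Inf_chain:
  assumes K: "K \<noteq> {}" "\<And>p. p \<in> K \<Longrightarrow> affine_gauge p \<and> p \<le> d"
    and chain: "\<And>p q. p \<in> K \<Longrightarrow> q \<in> K \<Longrightarrow> p \<le> q \<or> q \<le> p"
  defines "r \<equiv> \<lambda>x y. INF p\<in>K. p x y"
  shows "affine_gauge r" "\<And>p. p \<in> K \<Longrightarrow> r \<le> p"
proof -
  have bdd: "bdd_below ((\<lambda>p. p x y) ` K)" for x y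
  proof (cases "x \<in> X \<and> y \<in> X")
    case True
    have "- d y x \<le> p x y" if "p \<in> K" for p
      using affine_gauge_triangle[of p x y x] affine_gauge_refl[of p x] True K(2)[OF that]
        le_funD[OF le_funD[of p d y], of x] by auto
    then show ?thesis by (rule bdd_belowI2)
  next
    case False
    then have "0 \<le> p x y" if "p \<in> K" for p
      using K(2)[OF that] by (auto simp: affine_gauge_def)
    then show ?thesis by (rule bdd_belowI2)
  qed
  have low: "r x y \<le> p x y" if "p \<in> K" for p x y
    unfolding r_def by (rule cINF_lower[OF bdd that])
  show "r \<le> p" if "p \<in> K" for p
    using low[OF that] by (simp add: le_fun_def)
  have tri: "r x z \<le> r x y + r y z" if "x \<in> X" "y \<in> X" "z \<in> X" for x y z
  proof -
    have "r x z \<le> p x y + q y z" if pq: "p \<in> K" "q \<in> K" for p q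
    proof -
      obtain s where s: "s \<in> K" "s \<le> p" "s \<le> q"
        using chain[OF pq] pq by auto
      then have "s x y \<le> p x y" "s y z \<le> q y z" by (auto simp: le_fun_def)
      moreover have "s x z \<le> s x y + s y z"
        using K(2)[OF s(1)] \<open>x \<in> X\<close> \<open>y \<in> X\<close> \<open>z \<in> X\<close> affine_gauge_triangle by blast
      ultimately show ?thesis using low[OF s(1), of x z] by linarith
    qed
    then have "r x z - p x y \<le> q y z" if "p \<in> K" "q \<in> K" for p q
      using that by (simp add: diff_le_eq add.commute)
    then have "r x z - p x y \<le> (INF q\<in>K. q y z)" if "p \<in> K" for p
      using that K(1) by (intro cINF_greatest)
    then have "r x z - p x y \<le> r y z" if "p \<in> K" for p
      using that by (simp add: r_def)
    then have "r x z - r y z \<le> p x y" if "p \<in> K" for p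
      using that by (simp add: diff_le_eq add.commute)
    then have "r x z - r y z \<le> (INF p\<in>K. p x y)"
      using K(1) by (intro cINF_greatest)
    then have "r x z - r y z \<le> r x y"
      by (simp add: r_def)
    then show ?thesis by simp
  qed
  have hom: "r (cc l y x) (cc l z x) = l * r y z"
    if "x \<in> X" "y \<in> X" "z \<in> X" "l \<in> {0..1}" for x y z l
  proof -
    have "r (cc l y x) (cc l z x) = (INF p\<in>K. l * p y z)"
      unfolding r_def using K(2) that by (intro INF_cong) (auto simp: affine_gauge_cc)
    also have "\<dots> = l * r y z"
    proof (cases "l = 0")
      case True
      then show ?thesis using K(1) by simp
    next
      case False
      then have l: "l > 0" using that by auto
      show ?thesis
      proof (rule antisym)
        have bl: "bdd_below ((\<lambda>p. l * p y z) ` K)"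
          by (rule bdd_belowI2[where m = "l * r y z"]) (use l low in auto)
        have "(INF p\<in>K. l * p y z) / l \<le> p y z" if "p \<in> K" for p
          using cINF_lower[OF bl that] l by (simp add: pos_divide_le_eq mult.commute)
        then have "(INF p\<in>K. l * p y z) / l \<le> (INF p\<in>K. p y z)"
          using K(1) by (intro cINF_greatest)
        then show "(INF p\<in>K. l * p y z) \<le> l * r y z"
          using l by (simp add: r_def pos_divide_le_eq mult.commute)
        show "l * r y z \<le> (INF p\<in>K. l * p y z)"
          using K(1) l low by (intro cINF_greatest) auto
      qed
    qed
    finally show ?thesis .
  qed
  have "r x y = 0" if "x \<notin> X \<or> y \<notin> X" for x y
  proof -
    have "r x y = (INF p\<in>K. 0)"
      unfolding r_def using K(2) that by (intro INF_cong) (auto simp: affine_gauge_def)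
    then show ?thesis using K(1) by simp
  qed
  then show "affine_gauge r" using tri hom by (simp add: affine_gauge_def)
qed

lemma ex_minimal_affine_gauge:
  assumes "affine_gauge p"
  obtains q where "affine_gauge q" "q \<le> p" "\<And>r. affine_gauge r \<Longrightarrow> r \<le> q \<Longrightarrow> r = q"
proof -
  let ?A = "{q. affine_gauge q \<and> q \<le> p}"
  \<comment> \<open>The order is reversed: an upper bound of a chain is its pointwise infimum, and a
    maximal element is a minimal gauge.\<close>
  let ?P = "\<lambda>q r. r \<le> (q :: 'a \<Rightarrow> 'a \<Rightarrow> real)"
  have "\<exists>m\<in>?A. \<forall>a\<in>?A. ?P m a \<longrightarrow> a = m"
  proof (rule predicate_Zorn)
    show "partial_order_on ?A (relation_of ?P ?A)"
      by (rule partial_order_on_relation_ofI) auto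
    fix C assume C: "C \<in> Chains (relation_of ?P ?A)"
    show "\<exists>u\<in>?A. \<forall>a\<in>C. ?P a u"
    proof (cases "C = {}")
      case True
      then show ?thesis using assms by auto
    next
      case False
      have 1: "affine_gauge q \<and> q \<le> p" if "q \<in> C" for q
        using C that by (auto simp: Chains_def relation_of_def)
      have 2: "q \<le> r \<or> r \<le> q" if "q \<in> C" "r \<in> C" for q r
        using C that by (auto simp: Chains_def relation_of_def)
      let ?r = "\<lambda>x y. INF p\<in>C. p x y"
      have "affine_gauge ?r" "\<And>q. q \<in> C \<Longrightarrow> ?r \<le> q"
        using affine_gauge_Inf_chain[OF False 1 2] by auto
      moreover have "?r \<le> p"
      proof -
        obtain q where "q \<in> C" using False by blast
        then show ?thesis using 1 calculation(2) order_trans by blast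
      qed
      ultimately show ?thesis by blast
    qed
  qed
  then obtain m where m: "affine_gauge m" "m \<le> p"
    and max: "\<And>r. affine_gauge r \<Longrightarrow> r \<le> p \<Longrightarrow> r \<le> m \<Longrightarrow> r = m"
    by auto
  \<comment> \<open>A gauge below \<open>m\<close> is also below \<open>p\<close>, so minimality
    below \<open>p\<close> is minimality among all gauges.\<close>
  show thesis
    by (rule that[OF m]) (use max m(2) order_trans in blast)
qed

section \<open>Lowering a gauge in a given direction\<close>

text \<open>For \<open>p x y = N (x - y)\<close> this is
  \<open>N (x - y + t (a - b)) - t N (a - b)\<close>. The factor \<open>1 + t\<close> undoes the
  normalisation of \<open>x + t a\<close> and \<open>y + t b\<close> to convex combinations.\<close>

definition gap :: "('a \<Rightarrow> 'a \<Rightarrow> real) \<Rightarrow> 'a \<Rightarrow> 'a \<Rightarrow> 'a \<Rightarrow> 'a \<Rightarrow> real \<Rightarrow> real" where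
  "gap p a b x y t = (1 + t) * p (cc (1 / (1 + t)) x a) (cc (1 / (1 + t)) y b) - t * p a b"

lemma gap_zero: "x \<in> X \<Longrightarrow> y \<in> X \<Longrightarrow> a \<in> X \<Longrightarrow> b \<in> X \<Longrightarrow> gap p a b x y 0 = p x y"
  by (simp add: gap_def cc_one)

text \<open>Up to normalisation, this is the triangle inequality from \<open>y + t a\<close> through
  \<open>x + t a\<close> to \<open>y + t b\<close>. The bound is independent of \<open>t\<close>, so
  the infimum over \<open>t\<close> is finite.\<close>

lemma gap_lower:
  assumes "affine_gauge p" "x \<in> X" "y \<in> X" "a \<in> X" "b \<in> X" "t \<ge> 0"
  shows "- p y x \<le> gap p a b x y t"
proof -
  define s where "s = 1 / (1 + t)"
  have s: "s \<in> {0..1}" "(1 + t) * s = 1" using assms by (auto simp: s_def)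
  have "p (cc s y a) (cc s y b) \<le> p (cc s y a) (cc s x a) + p (cc s x a) (cc s y b)"
    using assms s by (intro affine_gauge_triangle) (auto intro: cc_closed)
  then have "(1 - s) * p a b \<le> s * p y x + p (cc s x a) (cc s y b)"
    using assms s by (simp add: affine_gauge_cc affine_gauge_cc_left)
  then have "(1 + t) * ((1 - s) * p a b) \<le> (1 + t) * (s * p y x + p (cc s x a) (cc s y b))"
    using assms by (intro mult_left_mono) auto
  also have "(1 + t) * ((1 - s) * p a b) = (1 + t - (1 + t) * s) * p a b"
    by (simp add: algebra_simps)
  also have "\<dots> = t * p a b" by (simp add: s(2))
  also have "(1 + t) * (s * p y x + p (cc s x a) (cc s y b))
      = ((1 + t) * s) * p y x + (1 + t) * p (cc s x a) (cc s y b)"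
    by (simp add: algebra_simps)
  also have "\<dots> = p y x + (1 + t) * p (cc s x a) (cc s y b)" by (simp add: s(2))
  finally show ?thesis unfolding gap_def s_def by linarith
qed

text \<open>Up to normalisation, pass from \<open>x + (t + s) a\<close> to
  \<open>z + (t + s) b\<close> through \<open>y + t b + s a\<close>. The ends of the first leg share
  the summand \<open>s a\<close>, those of the second \<open>t b\<close>, so homogeneity reduces the
  legs to the two gaps.\<close>

lemma gap_triangle:
  assumes p: "affine_gauge p" and X: "x \<in> X" "y \<in> X" "z \<in> X" "a \<in> X" "b \<in> X"
    and t: "t \<ge> 0" and s: "s \<ge> 0"
  shows "gap p a b x z (t + s) \<le> gap p a b x y t + gap p a b y z s"
proof -
  define u where "u = 1 / (1 + (t + s))"
  define \<theta> where "\<theta> = (1 + t) / (1 + (t + s))"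
  define \<eta> where "\<eta> = (1 + s) / (1 + (t + s))"
  define m where "m = 1 / (1 + t)"
  define k where "k = 1 / (1 + s)"
  have I: "u \<in> {0..1}" "\<theta> \<in> {0..1}" "\<eta> \<in> {0..1}" "m \<in> {0..1}" "k \<in> {0..1}"
    using t s by (auto simp: u_def \<theta>_def \<eta>_def m_def k_def)
  have pos: "1 + (t + s) \<noteq> 0" "1 + t \<noteq> 0" "1 + s \<noteq> 0" using t s by auto
  have w: "\<theta> * m = u" "\<eta> * k = u" "1 - \<eta> = \<theta> * (1 - m)"
    "(1 + (t + s)) * \<theta> = 1 + t" "(1 + (t + s)) * \<eta> = 1 + s"
    using pos by (simp_all add: u_def \<theta>_def \<eta>_def m_def k_def right_diff_distrib diff_divide_eq_iff
        diff_eq_eq)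
  have P0: "cc u x a = cc \<theta> (cc m x a) a"
    using cc_absorb_right[of \<theta> m x a] I X w(1) by simp
  have P1: "cc \<theta> (cc m y b) a = cc \<eta> (cc k y a) b"
    using w(1-3) by (intro cc_swap I X) simp_all
  have P2: "cc u z b = cc \<eta> (cc k z b) b"
    using cc_absorb_right[of \<eta> k z b] I X w(2) by simp
  have c: "cc m x a \<in> X" "cc m y b \<in> X" "cc k y a \<in> X" "cc k z b \<in> X"
    using I X by (auto intro: cc_closed)
  have "p (cc u x a) (cc u z b) \<le> p (cc u x a) (cc \<theta> (cc m y b) a) + p (cc \<theta> (cc m y b) a) (cc u z b)"
    using p I X c by (intro affine_gauge_triangle) (auto intro: cc_closed)
  also have "p (cc u x a) (cc \<theta> (cc m y b) a) = \<theta> * p (cc m x a) (cc m y b)"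
    unfolding P0 using p I X c by (intro affine_gauge_cc) auto
  also have "p (cc \<theta> (cc m y b) a) (cc u z b) = \<eta> * p (cc k y a) (cc k z b)"
    unfolding P1 P2 using p I X c by (intro affine_gauge_cc) auto
  finally have "(1 + (t + s)) * p (cc u x a) (cc u z b)
      \<le> (1 + (t + s)) * (\<theta> * p (cc m x a) (cc m y b) + \<eta> * p (cc k y a) (cc k z b))"
    using t s by (intro mult_left_mono) auto
  also have "\<dots> = ((1 + (t + s)) * \<theta>) * p (cc m x a) (cc m y b)
      + ((1 + (t + s)) * \<eta>) * p (cc k y a) (cc k z b)"
    by (simp only: distrib_left mult.assoc)
  finally show ?thesis
    unfolding w(4,5) unfolding gap_def u_def m_def k_def by (simp add: algebra_simps)
qed

text \<open>Up to normalisation, \<open>l y + (1 - l) x + l s a\<close> is a mixture of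
  \<open>y + s a\<close> with \<open>x\<close>, and likewise for \<open>z\<close> and
  \<open>b\<close>. Homogeneity removes the common \<open>x\<close>, and the parameter scales along
  to \<open>l * s\<close>.\<close>

lemma gap_cc:
  assumes p: "affine_gauge p" and X: "x \<in> X" "y \<in> X" "z \<in> X" "a \<in> X" "b \<in> X"
    and l: "0 \<le> l" "l \<le> 1" and s: "s \<ge> 0"
  shows "gap p a b (cc l y x) (cc l z x) (l * s) = l * gap p a b y z s"
proof -
  define u where "u = 1 / (1 + l * s)"
  define m where "m = 1 / (1 + s)"
  \<comment> \<open>The weight of the normalised \<open>y + s a\<close> within the total mass
    \<open>1 + l * s\<close>.\<close>
  define \<theta> where "\<theta> = l * (1 + s) / (1 + l * s)"
  have ls: "l * s \<ge> 0" using l s by simp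
  then have "u \<in> {0..1}" by (simp add: u_def)
  with s l have I: "u \<in> {0..1}" "m \<in> {0..1}" "l \<in> {0..1}" by (simp_all add: m_def)
  have "l * (1 + s) \<le> 1 + l * s" using l by (simp add: distrib_left)
  then have "\<theta> \<le> 1" unfolding \<theta>_def using ls by (subst pos_divide_le_eq) simp_all
  moreover have "0 \<le> \<theta>" using ls l s by (simp add: \<theta>_def)
  ultimately have I': "\<theta> \<in> {0..1}" by simp
  have pos: "1 + l * s \<noteq> 0" "1 + s \<noteq> 0" using ls s by linarith+
  have w: "\<theta> * m = u * l" "(1 + l * s) * \<theta> = l * (1 + s)"
    using pos by (simp_all add: u_def m_def \<theta>_def)
  have "1 - \<theta> = (1 + l * s - l * (1 + s)) / (1 + l * s)"
    using pos by (simp add: \<theta>_def diff_divide_distrib)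
  then have w': "1 - \<theta> = u * (1 - l)" by (simp add: u_def distrib_left)
  have "cc u (cc l v x) c = cc \<theta> (cc m v c) x" if "v \<in> X" "c \<in> X" for v c
    using w(1) w' by (intro cc_swap I I' X that)
  then have "p (cc u (cc l y x) a) (cc u (cc l z x) b) = \<theta> * p (cc m y a) (cc m z b)"
    using I I' X p by (simp add: affine_gauge_cc cc_closed)
  then have "(1 + l * s) * p (cc u (cc l y x) a) (cc u (cc l z x) b)
      = (l * (1 + s)) * p (cc m y a) (cc m z b)"
    using w(2) by (simp only: mult.assoc[symmetric])
  then show ?thesis unfolding gap_def u_def m_def by (simp add: algebra_simps)
qed

text \<open>The largest gauge below \<open>p\<close> that is at most \<open>- p a b\<close> at \<open>(b, a)\<close>. If \<open>p x y\<close> is thought of as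
  \<open>N (x - y)\<close> for a sublinear \<open>N\<close>, it is \<open>v \<mapsto> INF t\<ge>0. N (v + t (a - b)) - t N (a - b)\<close>.\<close>
definition directional_gauge :: "('a \<Rightarrow> 'a \<Rightarrow> real) \<Rightarrow> 'a \<Rightarrow> 'a \<Rightarrow> 'a \<Rightarrow> 'a \<Rightarrow> real" where
  "directional_gauge p a b x y = (if x \<in> X \<and> y \<in> X then INF t\<in>{0..}. gap p a b x y t else 0)"

context
  fixes p a b
  assumes p: "affine_gauge p" and ab: "a \<in> X" "b \<in> X"
begin

lemma bdd_below_gap: "x \<in> X \<Longrightarrow> y \<in> X \<Longrightarrow> bdd_below (gap p a b x y ` {0..})"
  using gap_lower[OF p _ _ ab] by (intro bdd_belowI2[where m = "- p y x"]) auto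

lemma directional_gauge_le_gap:
  "x \<in> X \<Longrightarrow> y \<in> X \<Longrightarrow> t \<ge> 0 \<Longrightarrow> directional_gauge p a b x y \<le> gap p a b x y t"
  unfolding directional_gauge_def by (simp add: cINF_lower bdd_below_gap)

lemma directional_gauge_greatest:
  "x \<in> X \<Longrightarrow> y \<in> X \<Longrightarrow> (\<And>t. t \<ge> 0 \<Longrightarrow> c \<le> gap p a b x y t) \<Longrightarrow> c \<le> directional_gauge p a b x y"
  unfolding directional_gauge_def by (auto intro!: cINF_greatest)

lemma directional_gauge_le: "directional_gauge p a b \<le> p"
proof (intro le_funI)
  show "directional_gauge p a b x y \<le> p x y" for x y
  proof (cases "x \<in> X \<and> y \<in> X")
    case True
    then show ?thesis using directional_gauge_le_gap[of x y 0] gap_zero ab by auto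
  next
    case False
    then show ?thesis using p by (auto simp: directional_gauge_def affine_gauge_def)
  qed
qed

text \<open>At \<open>t = 1\<close> both mixtures are the midpoint of \<open>a\<close> and
  \<open>b\<close>, so only \<open>- p a b\<close> is left of the gap.\<close>

lemma directional_gauge_opposite: "directional_gauge p a b b a \<le> - p a b"
proof -
  have "cc (1 / 2) b a = cc (1 / 2) a b" using cc_commute[of "1 / 2" b a] ab by simp
  then have "gap p a b b a 1 = - p a b"
    using affine_gauge_refl[OF p, of "cc (1 / 2) a b"] ab by (simp add: gap_def cc_closed)
  then show ?thesis using directional_gauge_le_gap[of b a 1] ab by simp
qed

text \<open>The parameters of the two gaps vary independently, so the triangle inequality survives
  the infima. For \<open>l > 0\<close>, multiplication by \<open>l\<close> maps the half-line of
  parameters onto itself, which gives homogeneity.\<close>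

lemma affine_gauge_directional_gauge: "affine_gauge (directional_gauge p a b)"
proof -
  let ?q = "directional_gauge p a b"
  have tri: "?q x z \<le> ?q x y + ?q y z" if "x \<in> X" "y \<in> X" "z \<in> X" for x y z
  proof -
    have "?q x z - gap p a b x y t \<le> ?q y z" if t: "t \<ge> 0" for t
    proof (rule directional_gauge_greatest)
      fix s :: real assume s: "s \<ge> 0"
      show "?q x z - gap p a b x y t \<le> gap p a b y z s"
        using directional_gauge_le_gap[of x z "t + s"] gap_triangle[OF p _ _ _ ab t s, of x y z] t s
          \<open>x \<in> X\<close> \<open>y \<in> X\<close> \<open>z \<in> X\<close> by simp
    qed fact+
    then have "?q x z - ?q y z \<le> ?q x y"
      using that by (intro directional_gauge_greatest) (simp_all add: algebra_simps)
    then show ?thesis by simp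
  qed
  have hom: "?q (cc l y x) (cc l z x) = l * ?q y z"
    if X: "x \<in> X" "y \<in> X" "z \<in> X" and "l \<in> {0..1}" for x y z l
  proof -
    have l: "0 \<le> l" "l \<le> 1" using that by auto
    have c: "cc l y x \<in> X" "cc l z x \<in> X" using that by (auto intro: cc_closed)
    have le: "?q (cc l y x) (cc l z x) \<le> l * gap p a b y z s" if "s \<ge> 0" for s
      using directional_gauge_le_gap[OF c, of "l * s"] gap_cc[OF p X ab l that] l that by simp
    show ?thesis
    proof (cases "l = 0")
      \<comment> \<open>For \<open>l = 0\<close> only the value at \<open>(x, x)\<close> is at
        stake: it is nonnegative by the lower bound for gaps, and at most 0 by the gap at parameter
        0.\<close>
      case True
      have "0 \<le> gap p a b x x t" if "t \<ge> 0" for t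
        using gap_lower[OF p X(1,1) ab that] affine_gauge_refl[OF p X(1)] by simp
      then have "0 \<le> ?q x x" using X by (intro directional_gauge_greatest)
      then show ?thesis using le[of 0] True X by (simp add: cc_zero)
    next
      case False
      then have l0: "l > 0" using l by simp
      have "?q (cc l y x) (cc l z x) / l \<le> ?q y z"
        using le l0 X by (intro directional_gauge_greatest) (simp_all add: field_simps)
      moreover have "l * ?q y z \<le> ?q (cc l y x) (cc l z x)"
      proof (rule directional_gauge_greatest[OF c])
        fix t :: real assume t: "t \<ge> 0"
        then show "l * ?q y z \<le> gap p a b (cc l y x) (cc l z x) t"
          using gap_cc[OF p X ab l, of "t / l"] directional_gauge_le_gap[of y z "t / l"] l0 X
          by simp
      qed
      ultimately show ?thesis using l0 by (simp add: field_simps)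
    qed
  qed
  show ?thesis unfolding affine_gauge_def using tri hom by (auto simp: directional_gauge_def)
qed

end

section \<open>A Hahn-Banach theorem for affine functions\<close>

text \<open>By minimality, lowering \<open>p\<close> in the direction of \<open>x\<close> and
  \<open>y\<close> does not change it, which forces \<open>p y x \<le> - p x y\<close>. The other
  inequality comes from \<open>p x x = 0\<close>.\<close>

lemma minimal_affine_gauge_antisym:
  assumes p: "affine_gauge p" and min: "\<And>r. affine_gauge r \<Longrightarrow> r \<le> p \<Longrightarrow> r = p"
    and "x \<in> X" "y \<in> X"
  shows "p y x = - p x y"
proof -
  have "directional_gauge p x y = p"
    using assms by (intro min affine_gauge_directional_gauge directional_gauge_le)
  then have "p y x \<le> - p x y"
    using directional_gauge_opposite[OF assms(1,3,4)] by simp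
  moreover have "0 \<le> p x y + p y x"
    using affine_gauge_triangle[OF p, of x y x] affine_gauge_refl[OF p, of x] assms by simp
  ultimately show ?thesis by simp
qed

definition dominated_affine :: "('a \<Rightarrow> 'a \<Rightarrow> real) \<Rightarrow> ('a \<Rightarrow> real) set" where
  "dominated_affine p = {f. (\<forall>x\<in>X. \<forall>y\<in>X. \<forall>l\<in>{0..1}. f (cc l x y) = l * f x + (1 - l) * f y) \<and>
     (\<forall>x\<in>X. \<forall>y\<in>X. f x - f y \<le> p x y)}"

text \<open>A minimal gauge \<open>q\<close> gives the affine function \<open>q x a\<close> of
  \<open>x\<close>. Taking \<open>q\<close> below the directional gauge, not merely below
  \<open>p\<close>, yields \<open>q b a \<le> - p a b\<close>, so that the bound at
  \<open>(a, b)\<close> is attained.\<close>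

lemma ex_dominated_affine_attaining:
  assumes p: "affine_gauge p" and ab: "a \<in> X" "b \<in> X"
  obtains f where "f \<in> dominated_affine p" "f a - f b = p a b"
proof -
  obtain q where q: "affine_gauge q" "q \<le> directional_gauge p a b"
    and min: "\<And>r. affine_gauge r \<Longrightarrow> r \<le> q \<Longrightarrow> r = q"
    using ex_minimal_affine_gauge[OF affine_gauge_directional_gauge[OF p ab]] by metis
  have qp: "q x y \<le> p x y" for x y
    using order_trans[OF q(2) directional_gauge_le[OF p ab]] by (simp add: le_fun_def)
  note anti = minimal_affine_gauge_antisym[OF q(1) min]
  \<comment> \<open>Antisymmetry turns the triangle inequality into additivity.\<close>
  have diff: "q x y = q x a - q y a" if "x \<in> X" "y \<in> X" for x y
    using affine_gauge_triangle[OF q(1), of x a y] affine_gauge_triangle[OF q(1), of x y a]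
      anti[of y a] that ab by simp
  have "q (cc l x y) a = l * q x a + (1 - l) * q y a"
    if "x \<in> X" "y \<in> X" "l \<in> {0..1}" for x y l
  proof -
    \<comment> \<open>Writing \<open>y\<close> as \<open>cc l y y\<close> makes homogeneity
      applicable.\<close>
    have "q (cc l x y) a - q y a = q (cc l x y) (cc l y y)"
      using that diff[of "cc l x y" y] by (simp add: cc_idem cc_closed)
    also have "\<dots> = l * (q x a - q y a)"
      using that q(1) diff[of x y] by (simp add: affine_gauge_cc)
    finally show ?thesis by (simp add: algebra_simps)
  qed
  moreover have "q x a - q y a \<le> p x y" if "x \<in> X" "y \<in> X" for x y
    using diff[OF that] qp[of x y] by simp
  ultimately have "(\<lambda>x. q x a) \<in> dominated_affine p" by (simp add: dominated_affine_def)
  moreover have "q a a - q b a = p a b"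
  proof -
    have "q b a \<le> - p a b"
      using q(2) directional_gauge_opposite[OF p ab] by (auto simp: le_fun_def intro: order_trans)
    then show ?thesis using diff[OF ab] qp[of a b] anti[OF _ _ ab] by linarith
  qed
  ultimately show thesis by (rule that)
qed

end

section \<open>Contractive metrics scale exactly\<close>

locale contractive_convex_space = convex_space X cc + Metric_space X d
  for X :: "'a set" and cc d +
  assumes contractive: "cc_contractive X cc d"
begin

lemma dist_cc_le:
  "l \<in> {0..1} \<Longrightarrow> x \<in> X \<Longrightarrow> y \<in> X \<Longrightarrow> z \<in> X \<Longrightarrow> d (cc l y x) (cc l z x) \<le> l * d y z"
  using contractive by (simp add: cc_contractive_def)

text \<open>Scaling \<open>l y + (1 - l) x\<close> to \<open>y + w\<close>, the parameter \<open>2 l / (1 + l)\<close> belongs to \<open>2 y + w\<close>.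
  The path from \<open>2 y + w\<close> to \<open>2 z + w\<close> runs through \<open>y + z + w\<close>, and both halves arise from
  \<open>y + w\<close> and \<open>z + w\<close> by mixing with a common point.\<close>
lemma dist_cc_double:
  assumes l: "0 < l" "l \<le> 1" and X: "x \<in> X" "y \<in> X" "z \<in> X"
  shows "d (cc (2 * l / (1 + l)) y x) (cc (2 * l / (1 + l)) z x)
    \<le> 2 / (1 + l) * d (cc l y x) (cc l z x)"
proof -
  \<comment> \<open>With \<open>1 - a = a * l\<close>, mixing \<open>y\<close> into
    \<open>cc l y x\<close> adds a second share of \<open>y\<close> equal to the first.\<close>
  define a where "a = 1 / (1 + l)"
  have I: "a \<in> {0..1}" "l \<in> {0..1}" using l by (auto simp: a_def)
  have e: "1 - a * (1 - l) = 2 * l / (1 + l)" "1 - a = a * l"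
    using l by (simp_all add: a_def field_simps)
  have c: "cc l y x \<in> X" "cc l z x \<in> X" using I X by (auto intro: cc_closed)
  have same: "cc a (cc l v x) v = cc (2 * l / (1 + l)) v x" if "v \<in> X" for v
    using cc_absorb_left[of a l x v] I X that e by simp
  have mid: "cc a (cc l z x) y = cc a (cc l y x) z"
  proof -
    have "cc a (cc l z x) y = cc a (cc (1 - l) x z) y" using I X by (simp add: cc_commute[of l])
    also have "\<dots> = cc a (cc (1 - l) x y) z"
      using I X e(2) by (intro cc_swap) auto
    also have "\<dots> = cc a (cc l y x) z" using I X by (simp add: cc_commute[of l])
    finally show ?thesis .
  qed
  have "d (cc a (cc l y x) y) (cc a (cc l z x) z)
      \<le> d (cc a (cc l y x) y) (cc a (cc l z x) y) + d (cc a (cc l z x) y) (cc a (cc l z x) z)"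
    using I X c by (intro triangle) (auto intro: cc_closed)
  also have "\<dots> \<le> a * d (cc l y x) (cc l z x) + a * d (cc l y x) (cc l z x)"
    unfolding mid using I X c dist_cc_le mid by (intro add_mono) metis+
  finally show ?thesis using X by (simp add: same) (simp add: a_def)
qed

text \<open>Contractivity with weight \<open>1 - l\<close>, comparing \<open>y\<close> as a mixture
  of \<open>y\<close> with itself to \<open>cc (1 - l) x y\<close>.\<close>

lemma dist_cc_near:
  assumes "l \<in> {0..1}" "x \<in> X" "y \<in> X"
  shows "d y (cc l y x) \<le> (1 - l) * d y x"
  using assms dist_cc_le[of "1 - l" y y x] by (simp add: cc_idem cc_commute[of l y x])

text \<open>For the distance \<open>G s\<close> from \<open>y + s x\<close> to \<open>z + s x\<close>, scaled from mass \<open>1\<close> to mass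
  \<open>1 + s\<close>, the doubling estimate says \<open>G (s / 2) \<le> G s\<close>, while \<open>G s\<close> tends to \<open>d y z\<close>
  for \<open>s\<close> tending to \<open>0\<close>.\<close>
lemma dist_cc_eq:
  assumes l: "l \<in> {0..1}" and X: "x \<in> X" "y \<in> X" "z \<in> X"
  shows "d (cc l y x) (cc l z x) = l * d y z"
proof (cases "l = 0")
  case True
  then show ?thesis using X by (simp add: cc_zero)
next
  case False
  define G where "G s = (1 + s) * d (cc (1 / (1 + s)) y x) (cc (1 / (1 + s)) z x)" for s
  have half: "G (s / 2) \<le> G s" if "s \<ge> 0" for s
  proof -
    define m where "m = 1 / (1 + s)"
    have m: "0 < m" "m \<le> 1" using that by (auto simp: m_def)
    have e: "2 * m / (1 + m) = 1 / (1 + s / 2)" "(1 + s / 2) * (2 / (1 + m)) = 1 + s"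
      using that by (auto simp: m_def divide_simps) (simp add: algebra_simps)
    have "G (s / 2) \<le> (1 + s / 2) * (2 / (1 + m) * d (cc m y x) (cc m z x))"
      unfolding G_def using dist_cc_double[OF m X] that unfolding e(1)
      by (intro mult_left_mono) auto
    also have "\<dots> = G s" unfolding mult.assoc[symmetric] e(2) by (simp add: G_def m_def)
    finally show ?thesis .
  qed
  \<comment> \<open>The value for which \<open>y + s x\<close>, once normalised, is
    \<open>cc l y x\<close>.\<close>
  define s where "s = (1 - l) / l"
  have s: "s \<ge> 0" "1 / (1 + s) = l" using l False by (auto simp: s_def field_simps)
  have it: "G (s / 2 ^ n) \<le> G s" for n
  proof (induction n)
    case (Suc n)
    have "G (s / 2 ^ n / 2) \<le> G (s / 2 ^ n)" using s by (intro half) simp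
    then show ?case using Suc by (simp add: mult.commute)
  qed simp
  \<comment> \<open>Mixing with \<open>x\<close> moves \<open>y\<close> and \<open>z\<close> by at
    most \<open>t\<close> times their distances to \<open>x\<close>, and the factor
    \<open>1 + t\<close> in \<open>G t\<close> only enlarges the middle term.\<close>
  have bound: "d y z \<le> t * (d y x + d z x) + G t" if t: "t \<ge> 0" for t
  proof -
    define m where "m = 1 / (1 + t)"
    have m: "m \<in> {0..1}" using t by (auto simp: m_def)
    have "1 - m = t / (1 + t)" using t by (simp add: m_def field_simps)
    also have "\<dots> \<le> t" using t by (simp add: divide_le_eq distrib_left)
    finally have mt: "1 - m \<le> t" .
    have c: "cc m y x \<in> X" "cc m z x \<in> X" using m X by (auto intro: cc_closed)
    have "d y z \<le> d y (cc m y x) + d (cc m y x) (cc m z x) + d z (cc m z x)"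
      using triangle[of y "cc m y x" z] triangle[of "cc m y x" "cc m z x" z] X c
        commute[of z "cc m z x"] by linarith
    also have "\<dots> \<le> (1 - m) * d y x + d (cc m y x) (cc m z x) + (1 - m) * d z x"
      using m X by (intro add_mono dist_cc_near) auto
    also have "\<dots> \<le> t * d y x + G t + t * d z x"
    proof (intro add_mono mult_right_mono mt nonneg)
      show "d (cc m y x) (cc m z x) \<le> G t"
        using mult_right_mono[of 1 "1 + t" "d (cc m y x) (cc m z x)"] t by (simp add: G_def m_def)
    qed
    finally show ?thesis by (simp add: algebra_simps)
  qed
  have "(\<lambda>n. s / 2 ^ n * (d y x + d z x) + G s) \<longlonglongrightarrow> 0 * (d y x + d z x) + G s"
    by (intro tendsto_intros LIMSEQ_divide_realpow_zero) simp
  moreover have "d y z \<le> s / 2 ^ n * (d y x + d z x) + G s" for n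
    using bound[of "s / 2 ^ n"] it[of n] s by simp
  ultimately have "d y z \<le> G s"
    by (intro LIMSEQ_le_const[where X = "\<lambda>n. s / 2 ^ n * (d y x + d z x) + G s"]) auto
  also have "G s = d (cc l y x) (cc l z x) / l"
    unfolding G_def s(2) using False by (simp add: s_def field_simps)
  finally have "l * d y z \<le> d (cc l y x) (cc l z x)"
    using l False by (simp add: pos_le_divide_eq mult.commute)
  then show ?thesis using dist_cc_le[OF l X] by simp
qed

section \<open>Isometric embedding by evaluation\<close>

text \<open>A gauge vanishes off \<open>X\<close>, whereas the metric need not.\<close>

definition dist_gauge :: "'a \<Rightarrow> 'a \<Rightarrow> real" where
  "dist_gauge x y = (if x \<in> X \<and> y \<in> X then d x y else 0)"

lemma affine_gauge_dist_gauge: "affine_gauge dist_gauge"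
  unfolding affine_gauge_def dist_gauge_def
  by (intro conjI ballI allI impI) (auto simp: cc_closed dist_cc_eq triangle)

lemma dominated_affine_dist_le:
  assumes "f \<in> dominated_affine dist_gauge" "x \<in> X" "y \<in> X"
  shows "\<bar>f x - f y\<bar> \<le> d x y"
proof -
  have "f u - f v \<le> d u v" if "u \<in> X" "v \<in> X" for u v
    using assms(1) that by (simp add: dominated_affine_def dist_gauge_def)
  from this[of x y] this[of y x] show ?thesis
    using assms commute[of x y] by linarith
qed

text \<open>Subtracting the value at the base point \<open>x0\<close> makes the function bounded, by
  \<open>d x x0\<close>. The index type contains all real functions, so those outside the dominated
  affine ones get the value 0.\<close>

definition evaluation :: "'a \<Rightarrow> 'a \<Rightarrow> 'a large_banach" where
  "evaluation x0 x = Bcontfun (\<lambda>F. if of_discrete F \<in> dominated_affine dist_gauge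
     then of_discrete F x - of_discrete F x0 else 0)"

lemma apply_evaluation:
  assumes "x0 \<in> X" "x \<in> X"
  shows "apply_bcontfun (evaluation x0 x) F = (if of_discrete F \<in> dominated_affine dist_gauge
     then of_discrete F x - of_discrete F x0 else 0)"
proof -
  have "(\<lambda>F. if of_discrete F \<in> dominated_affine dist_gauge
      then of_discrete F x - of_discrete F x0 else 0) \<in> bcontfun" (is "?g \<in> _")
  proof (rule bcontfun_normI)
    show "continuous_on UNIV ?g"
      by (simp add: continuous_on_open_vimage open_discrete)
    show "norm (?g F) \<le> d x x0" for F
      using dominated_affine_dist_le[OF _ assms(2,1)] nonneg by simp
  qed
  then show ?thesis unfolding evaluation_def by (simp add: Bcontfun_inverse)
qed

text \<open>Every admissible \<open>f\<close> is 1-Lipschitz, which bounds the supremum above; an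
  \<open>f\<close> attaining the distance of \<open>x\<close> and \<open>y\<close> bounds it
  below.\<close>

lemma norm_evaluation_diff:
  assumes "x0 \<in> X" "x \<in> X" "y \<in> X"
  shows "norm (evaluation x0 x - evaluation x0 y) = d x y"
proof (rule antisym)
  show "norm (evaluation x0 x - evaluation x0 y) \<le> d x y"
    using dominated_affine_dist_le[OF _ assms(2,3)] assms nonneg
    by (intro norm_bound) (simp add: apply_evaluation)
  obtain f where f: "f \<in> dominated_affine dist_gauge" "f x - f y = dist_gauge x y"
    using ex_dominated_affine_attaining[OF affine_gauge_dist_gauge assms(2,3)] .
  have "apply_bcontfun (evaluation x0 x - evaluation x0 y) (discrete f) = d x y"
    using f assms by (simp add: apply_evaluation discrete_inverse dist_gauge_def)
  then show "d x y \<le> norm (evaluation x0 x - evaluation x0 y)"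
    using norm_bounded[of "evaluation x0 x - evaluation x0 y" "discrete f"] nonneg[of x y] by simp
qed

text \<open>The subtracted value at \<open>x0\<close> is compatible with mixing because the weights
  sum to 1.\<close>

lemma evaluation_cc:
  assumes "x0 \<in> X" "x \<in> X" "y \<in> X" "l \<in> {0..1}"
  shows "evaluation x0 (cc l x y) = l *\<^sub>R evaluation x0 x + (1 - l) *\<^sub>R evaluation x0 y"
proof (rule bcontfun_eqI)
  fix F
  have "f (cc l x y) = l * f x + (1 - l) * f y" if "f \<in> dominated_affine dist_gauge" for f
    using that assms by (simp add: dominated_affine_def)
  then show "apply_bcontfun (evaluation x0 (cc l x y)) F
      = apply_bcontfun (l *\<^sub>R evaluation x0 x + (1 - l) *\<^sub>R evaluation x0 y) F"
    using assms by (simp add: apply_evaluation cc_closed) (simp add: algebra_simps)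
qed

lemma cc_isometry_evaluation:
  assumes "x0 \<in> X"
  shows "cc_isometry X cc d (evaluation x0 ` X) (evaluation x0)"
proof -
  have "inj_on (evaluation x0) X"
  proof (rule inj_onI)
    fix x y assume "x \<in> X" "y \<in> X" "evaluation x0 x = evaluation x0 y"
    then show "x = y" using norm_evaluation_diff[OF assms, of x y] zero[of x y] by simp
  qed
  then show ?thesis
    using assms by (simp add: cc_isometry_def inj_on_imp_bij_betw norm_evaluation_diff evaluation_cc)
qed

lemma ex_cc_isometry: "\<exists>(C :: 'a large_banach set) \<phi>. cc_isometry X cc d C \<phi>"
proof (cases "X = {}")
  \<comment> \<open>There is no base point here, but any function is an isometry of the empty
    space.\<close>
  case True
  then have "cc_isometry X cc d ({} :: 'a large_banach set) (\<lambda>_. 0)"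
    by (simp add: cc_isometry_def bij_betw_def)
  then show ?thesis by blast
next
  case False
  then show ?thesis using cc_isometry_evaluation by blast
qed

end

section \<open>Images of isometries, and the equivalences\<close>

lemma cc_isometry_convex:
  assumes "convex_space X cc" "cc_isometry X cc d C \<phi>"
  shows "convex C"
proof (rule convexI)
  interpret convex_space X cc by fact
  fix u v :: 'b and a b :: real
  assume "u \<in> C" "v \<in> C" and ab: "0 \<le> a" "0 \<le> b" "a + b = 1"
  have C: "C = \<phi> ` X" using assms(2) by (simp add: cc_isometry_def bij_betw_def)
  then obtain x y where xy: "x \<in> X" "y \<in> X" "u = \<phi> x" "v = \<phi> y"
    using \<open>u \<in> C\<close> \<open>v \<in> C\<close> by blast
  moreover have "b = 1 - a" "a \<in> {0..1}" using ab by auto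
  ultimately have "a *\<^sub>R u + b *\<^sub>R v = \<phi> (cc a x y)"
    using assms(2) by (simp add: cc_isometry_def)
  then show "a *\<^sub>R u + b *\<^sub>R v \<in> C" using C xy \<open>a \<in> {0..1}\<close> cc_closed by blast
qed

text \<open>A Cauchy sequence in \<open>C\<close> pulls back to one in \<open>X\<close>, whose limit
  is mapped to a limit in \<open>C\<close>; thus \<open>C\<close> is complete and hence
  closed.\<close>

lemma cc_isometry_closed:
  assumes "Metric_space X d" "Metric_space.mcomplete X d" "cc_isometry X cc d C \<phi>"
  shows "closed C"
proof (rule complete_imp_closed, rule completeI)
  interpret Metric_space X d by fact
  have C: "C = \<phi> ` X" and iso: "\<And>x y. x \<in> X \<Longrightarrow> y \<in> X \<Longrightarrow> norm (\<phi> x - \<phi> y) = d x y"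
    using assms(3) by (auto simp: cc_isometry_def bij_betw_def)
  fix f :: "nat \<Rightarrow> 'b" assume f: "\<forall>n. f n \<in> C" and "Cauchy f"
  have "\<forall>n. \<exists>x. x \<in> X \<and> f n = \<phi> x" using f C by auto
  from choice[OF this] obtain g where g: "\<And>n. g n \<in> X" "\<And>n. f n = \<phi> (g n)" by blast
  have "MCauchy g"
    unfolding MCauchy_def
  proof (intro conjI allI impI)
    fix e :: real assume "e > 0"
    then obtain N where "\<And>m n. m \<ge> N \<Longrightarrow> n \<ge> N \<Longrightarrow> dist (f m) (f n) < e"
      using \<open>Cauchy f\<close> unfolding Cauchy_def by blast
    then show "\<exists>N. \<forall>n n'. N \<le> n \<longrightarrow> N \<le> n' \<longrightarrow> d (g n) (g n') < e"
      using g by (auto simp: dist_norm iso)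
  qed (use g in auto)
  then obtain x where "limitin mtopology g x sequentially"
    using assms(2) by (auto simp: mcomplete_def)
  then have x: "x \<in> X" "\<And>e. e > 0 \<Longrightarrow> \<exists>N. \<forall>n\<ge>N. g n \<in> X \<and> d (g n) x < e"
    unfolding limit_metric_sequentially by auto
  have "f \<longlonglongrightarrow> \<phi> x"
    unfolding LIMSEQ_def using x g by (auto simp: dist_norm iso)
  then show "\<exists>l\<in>C. f \<longlonglongrightarrow> l" using x(1) C by blast
qed

text \<open>The terms with \<open>x\<close> cancel in the difference of the images, so even equality
  holds.\<close>

lemma cc_isometry_contractive:
  assumes "convex_space X cc" "cc_isometry X cc d C \<phi>"
  shows "cc_contractive X cc d"
  unfolding cc_contractive_def
proof (intro ballI)
  interpret convex_space X cc by fact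
  fix x y z and l :: real assume X: "x \<in> X" "y \<in> X" "z \<in> X" and l: "l \<in> {0..1}"
  have iso: "\<And>x y. x \<in> X \<Longrightarrow> y \<in> X \<Longrightarrow> d x y = norm (\<phi> x - \<phi> y)"
    and aff: "\<And>x y. x \<in> X \<Longrightarrow> y \<in> X \<Longrightarrow> \<phi> (cc l x y) = l *\<^sub>R \<phi> x + (1 - l) *\<^sub>R \<phi> y"
    using assms(2) l by (auto simp: cc_isometry_def)
  have "\<phi> (cc l y x) - \<phi> (cc l z x) = l *\<^sub>R (\<phi> y - \<phi> z)"
    using X by (simp add: aff scaleR_diff_right)
  then have "norm (\<phi> (cc l y x) - \<phi> (cc l z x)) = l * norm (\<phi> y - \<phi> z)"
    using l by simp
  then show "d (cc l y x) (cc l z x) \<le> l * d y z"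
    using X l by (simp add: iso cc_closed)
qed

lemma is_convex_subset_contractive:
  "convex_space X cc \<Longrightarrow> is_convex_subset_of TYPE('b::banach) X cc d \<Longrightarrow> cc_contractive X cc d"
  using cc_isometry_contractive by (auto simp: is_convex_subset_of_def)

lemma is_closed_convex_subset_imp:
  "is_closed_convex_subset_of TYPE('b::banach) X cc d \<Longrightarrow> is_convex_subset_of TYPE('b) X cc d"
  by (auto simp: is_convex_subset_of_def is_closed_convex_subset_of_def)

theorem corollary12:
  fixes X :: "'a set" and cc :: "real \<Rightarrow> 'a \<Rightarrow> 'a \<Rightarrow> 'a" and d :: "'a \<Rightarrow> 'a \<Rightarrow> real"
  assumes "convex_space X cc" and "Metric_space X d"
  shows "((is_convex_subset_of TYPE('a large_banach) X cc d \<longleftrightarrow> cc_contractive X cc d) \<and>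
          (is_convex_subset_of TYPE('b::banach) X cc d \<longrightarrow> cc_contractive X cc d)) \<and>
         (Metric_space.mcomplete X d \<longrightarrow>
          (is_closed_convex_subset_of TYPE('a large_banach) X cc d \<longleftrightarrow> cc_contractive X cc d) \<and>
          (is_closed_convex_subset_of TYPE('b) X cc d \<longrightarrow> cc_contractive X cc d))"
proof -
  \<comment> \<open>One isometry serves both parts: its image is always convex, and closed if the
    metric is complete.\<close>
  have embed: "\<exists>(C :: 'a large_banach set) \<phi>. cc_isometry X cc d C \<phi>" if "cc_contractive X cc d"
  proof -
    interpret contractive_convex_space X cc d
      using assms that by (simp add: contractive_convex_space_def contractive_convex_space_axioms_def)
    show ?thesis by (rule ex_cc_isometry)
  qed
  have "is_convex_subset_of TYPE('a large_banach) X cc d" if "cc_contractive X cc d"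
    using embed[OF that] cc_isometry_convex[OF assms(1)] unfolding is_convex_subset_of_def by metis
  moreover have "is_closed_convex_subset_of TYPE('a large_banach) X cc d"
    if "Metric_space.mcomplete X d" "cc_contractive X cc d"
    using embed[OF that(2)] cc_isometry_convex[OF assms(1)] cc_isometry_closed[OF assms(2) that(1)]
    unfolding is_closed_convex_subset_of_def by metis
  ultimately show ?thesis
    using is_convex_subset_contractive[OF assms(1)] is_closed_convex_subset_imp by metis
qed

end
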